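(* Let $\lambda>0$, $r>0$, $h(x)=x_1^2+x_2^2-r^2$, $\|x\|^2=x_1^2+x_2^2$, and consider on the open quadrant $Q=\{x\in\mathbb R^2:x_1<0,\ x_2<0\}$ the system $$\dot x_1=-\frac{\lambda h(x)}{2\|x\|^2}x_1,\qquad \dot x_2=-\frac{\lambda h(x)}{2\|x\|^2}x_2 .$$ Then: (i) the set of equilibria in $Q$ is exactly the arc $\{x\in Q:h(x)=0\}$, and along solutions $\dot h=-\lambda h$; (ii) at every equilibrium $x_e\in Q$ the Jacobian matrix of the right-hand side has eigenvalues $0$ and $-\lambda$; (iii) the function $\ln(-x_1)-\ln(-x_2)$ is constant along solutions; (iv) every equilibrium $x_e\in Q$ is stable (in the sense of Lyapunov).
   Context: The system is the joint closed-loop dynamics of two agents on perpendicular lines, $\dot x_i=v_i$ ($i=1,2$, $x_i$ the signed distance from the intersection point), under the Complete Control Set (CCS) policy with both agents' constraints active. Agent 1 minimizes $\|\bar v_{11}\|^2+\|v_{12}\|^2$ subject to $\lambda h+2\rho_1(x)x_1v_{01}+2x_1\bar v_{11}+2x_2v_{12}\ge0$ with $\rho_1=1+x_2^2/x_1^2$, and applies $v_1=v_{01}+\bar v_{11}$, where $v_{01}>0$ is its desired velocity; agent 2 is symmetric. The claim itself concerns only the displayed differential equation. *)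

theory Defs
  imports "HOL-Analysis.Analysis"
begin

definition quadrant :: "(real^2) set" where
  "quadrant = {x. x $ 1 < 0 \<and> x $ 2 < 0}"

definition h :: "real \<Rightarrow> real^2 \<Rightarrow> real" where
  "h r x = (x $ 1)\<^sup>2 + (x $ 2)\<^sup>2 - r\<^sup>2"

text \<open>The norm on \<^typ>\<open>real^2\<close> is the Euclidean one.
  The value at the origin (outside the quadrant) is an irrelevant artefact of division by zero.\<close>

definition ccs_field :: "real \<Rightarrow> real \<Rightarrow> real^2 \<Rightarrow> real^2" where
  "ccs_field lam r x =
     (\<chi> i. - ((lam * h r x) / (2 * (norm x)\<^sup>2)) * x $ i)"

definition equilibria :: "('a::real_normed_vector \<Rightarrow> 'a) \<Rightarrow> 'a set \<Rightarrow> 'a set" where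
  "equilibria f S = {x \<in> S. f x = 0}"

text \<open>Solutions of the autonomous equation with right-hand side \<open>f\<close> and state space \<open>S\<close>, on an
  arbitrary time interval \<open>J\<close> (derivatives at included end points are one-sided).\<close>

definition is_solution ::
    "('a::real_normed_vector \<Rightarrow> 'a) \<Rightarrow> 'a set \<Rightarrow> real set \<Rightarrow> (real \<Rightarrow> 'a) \<Rightarrow> bool" where
  "is_solution f S J x \<longleftrightarrow> is_interval J \<and>
     (\<forall>t\<in>J. x t \<in> S \<and> (x has_vector_derivative f (x t)) (at t within J))"

text \<open>Stability includes forward completeness: from every nearby initial state some
  solution exists for all \<open>t \<ge> 0\<close>. The bound is demanded of all solutions from that state, also of
  those given on a shorter time interval only. Uniqueness is not presupposed.\<close>

definition lyapunov_stable ::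
    "('a::real_normed_vector \<Rightarrow> 'a) \<Rightarrow> 'a set \<Rightarrow> 'a \<Rightarrow> bool" where
  "lyapunov_stable f S xe \<longleftrightarrow> xe \<in> equilibria f S \<and>
     (\<forall>\<epsilon>>0. \<exists>\<delta>>0. \<forall>x0\<in>S. norm (x0 - xe) < \<delta> \<longrightarrow>
        (\<exists>x. is_solution f S {0..} x \<and> x 0 = x0) \<and>
        (\<forall>J x. J \<subseteq> {0..} \<and> 0 \<in> J \<and> is_solution f S J x \<and> x 0 = x0 \<longrightarrow>
           (\<forall>t\<in>J. norm (x t - xe) < \<epsilon>)))"

text \<open>The complex spectrum of a real square matrix.\<close>

definition eigenvalues :: "real^'n^'n \<Rightarrow> complex set" where
  "eigenvalues A = {k. \<exists>v :: complex^'n. v \<noteq> 0 \<and>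
     map_matrix complex_of_real A *v v = k *s v}"

end

theory Submission
  imports Defs
begin

text \<open>The field is radial, so every solution stays on the ray through its initial state, and
  \<open>h\<close> decays exponentially. Hence \<open>\<parallel>x t\<parallel>\<close> stays between \<open>\<parallel>x 0\<parallel>\<close> and
  \<open>r\<close>, and \<open>x t\<close> is never further from \<open>x 0\<close> than the arc of equilibria is; \<open>\<delta> = \<epsilon> / 2\<close>
  therefore works in the definition of stability. A global solution is
  \<open>sqrt ((r\<^sup>2 + h\<^sub>0 exp (- \<lambda> t)) / \<parallel>x\<^sub>0\<parallel>\<^sup>2) x\<^sub>0\<close>. At an equilibrium
  only the derivative of \<open>h\<close> contributes to the Jacobian, which is the rank-one matrix
  \<open>- (\<lambda> / r\<^sup>2) x\<^sub>e x\<^sub>e\<^sup>T\<close>.\<close>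

section \<open>Radial form of the field and its zeros\<close>

lemma h_eq_inner: "h r x = x \<bullet> x - r\<^sup>2"
  by (simp add: h_def inner_vec_def sum_2 power2_eq_square)

text \<open>The scalar coefficient depends on \<open>x\<close> only through
  \<open>x \<bullet> x\<close>. This reduces differentiation of the field to a one-variable chain
  rule and the search for solutions to one unknown scale factor on a ray.\<close>

lemma ccs_field_eq_scaleR:
  "ccs_field lam r x = (- (lam * (x \<bullet> x - r\<^sup>2) / (2 * (x \<bullet> x)))) *\<^sub>R x"
  by (simp add: ccs_field_def h_eq_inner vec_eq_iff power2_norm_eq_inner)

lemma quadrant_inner_pos: "x \<in> quadrant \<Longrightarrow> x \<bullet> x > 0"
  by (auto simp: quadrant_def)

lemma scaleR_in_quadrant: "x \<in> quadrant \<Longrightarrow> k > 0 \<Longrightarrow> k *\<^sub>R x \<in> quadrant"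
  by (simp add: quadrant_def mult_pos_neg)

lemma equilibria_ccs_field:
  assumes "lam > 0"
  shows "equilibria (ccs_field lam r) quadrant = {x \<in> quadrant. h r x = 0}"
proof -
  have "ccs_field lam r x = 0 \<longleftrightarrow> h r x = 0" if "x \<in> quadrant" for x
    using quadrant_inner_pos[OF that] assms by (auto simp: ccs_field_eq_scaleR h_eq_inner)
  then show ?thesis by (auto simp: equilibria_def)
qed

section \<open>Evolution of \<open>h\<close> and of the direction along solutions\<close>

lemma h_has_derivative_along_solution:
  assumes "is_solution (ccs_field lam r) quadrant J x" "t \<in> J"
  shows "((\<lambda>s. h r (x s)) has_real_derivative - lam * h r (x t)) (at t within J)"
proof -
  have q: "x t \<bullet> x t > 0"
    and d: "(x has_derivative (\<lambda>s. s *\<^sub>R ccs_field lam r (x t))) (at t within J)"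
    using assms quadrant_inner_pos by (auto simp: is_solution_def has_vector_derivative_def)
  have "((\<lambda>s. x s \<bullet> x s - r\<^sup>2) has_derivative (\<lambda>s. s * (2 * (x t \<bullet> ccs_field lam r (x t)))))
      (at t within J)"
    by (rule derivative_eq_intros d refl ext)+ (simp add: inner_commute)
  moreover have "2 * (x t \<bullet> ccs_field lam r (x t)) = - lam * h r (x t)"
    using q by (simp add: ccs_field_eq_scaleR h_eq_inner)
  ultimately show ?thesis
    unfolding h_eq_inner has_field_derivative_def by (simp only: mult_commute_abs)
qed

text \<open>Both coordinates satisfy the same scalar equation \<open>y' = c y\<close> with a common
  time-dependent rate \<open>c\<close>, so both logarithms have derivative \<open>c\<close>, which
  cancels in the difference.\<close>

lemma ln_difference_constant_on:
  assumes "is_solution (ccs_field lam r) quadrant J x"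
  shows "(\<lambda>t. ln (- (x t $ 1)) - ln (- (x t $ 2))) constant_on J"
proof -
  have conv: "convex J" using assms by (simp add: is_solution_def is_interval_convex)
  have "((\<lambda>t. ln (- (x t $ 1)) - ln (- (x t $ 2))) has_real_derivative 0) (at t within J)"
    if "t \<in> J" for t
  proof -
    define c where "c = - ((lam * h r (x t)) / (2 * (norm (x t))\<^sup>2))"
    have q: "x t $ 1 < 0" "x t $ 2 < 0"
      and d: "(x has_vector_derivative ccs_field lam r (x t)) (at t within J)"
      using assms that by (auto simp: is_solution_def quadrant_def)
    have "((\<lambda>s. x s $ i) has_real_derivative c * x t $ i) (at t within J)" for i
      using bounded_linear.has_vector_derivative[OF bounded_linear_vec_nth d, of i]
      by (simp add: has_real_derivative_iff_has_vector_derivative ccs_field_def c_def)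
    then show ?thesis
      using q by (auto intro!: derivative_eq_intros)
  qed
  then show ?thesis
    using has_field_derivative_zero_constant[OF conv] unfolding constant_on_def by blast
qed

section \<open>Linearization at an equilibrium\<close>

text \<open>In the product rule for \<open>?g x *\<^sub>R x\<close> the term
  \<open>?g xe *\<^sub>R v\<close> vanishes because \<open>xe \<bullet> xe = r\<^sup>2\<close>. What
  remains is the derivative of \<open>?g\<close>, by the chain rule through
  \<open>s = x \<bullet> x\<close>.\<close>

lemma ccs_field_has_derivative_equilibrium:
  assumes "xe \<in> quadrant" "h r xe = 0"
  shows "(ccs_field lam r has_derivative (\<lambda>v. (- (lam / r\<^sup>2) * (xe \<bullet> v)) *\<^sub>R xe)) (at xe)"
proof -
  have eq: "xe \<bullet> xe = r\<^sup>2" and nz: "xe \<bullet> xe \<noteq> 0"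
    using assms quadrant_inner_pos[of xe] by (auto simp: h_eq_inner)
  then have r: "r \<noteq> 0" by auto
  let ?g = "\<lambda>x::real^2. - (lam * (x \<bullet> x - r\<^sup>2) / (2 * (x \<bullet> x)))"
  have "((\<lambda>s. - (lam * (s - r\<^sup>2) / (2 * s))) has_real_derivative - (lam / (2 * r\<^sup>2)))
      (at (xe \<bullet> xe))"
    unfolding eq using r
    by (auto intro!: derivative_eq_intros simp: power2_eq_square)
  moreover have "((\<lambda>x. x \<bullet> x) has_derivative (\<lambda>v. 2 * (xe \<bullet> v))) (at xe)"
    by (auto intro!: derivative_eq_intros simp: inner_commute)
  ultimately have "(?g has_derivative (\<lambda>v. 2 * (xe \<bullet> v) * - (lam / (2 * r\<^sup>2)))) (at xe)"
    by (rule DERIV_compose_FDERIV)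
  then have "(?g has_derivative (\<lambda>v. - (lam / r\<^sup>2) * (xe \<bullet> v))) (at xe)"
    by (simp add: mult.commute)
  then have "((\<lambda>x. ?g x *\<^sub>R x) has_derivative
      (\<lambda>v. ?g xe *\<^sub>R v + (- (lam / r\<^sup>2) * (xe \<bullet> v)) *\<^sub>R xe)) (at xe)"
    by (rule has_derivative_scaleR) (rule has_derivative_ident)
  moreover have "ccs_field lam r = (\<lambda>x. ?g x *\<^sub>R x)"
    by (rule ext) (rule ccs_field_eq_scaleR)
  ultimately show ?thesis by (simp add: eq)
qed

lemma eigenvalues_rank_one:
  fixes u :: "real^2"
  assumes "u \<noteq> 0"
  shows "eigenvalues (\<chi> i j. c * u $ i * u $ j) = {0, complex_of_real (c * (u \<bullet> u))}"
proof -
  let ?A = "map_matrix complex_of_real (\<chi> i j. c * u $ i * u $ j)"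
  let ?u = "(\<chi> i. complex_of_real (u $ i)) :: complex^2"
  \<comment> \<open>The form \<open>d\<close> is the complex-linear extension of the inner product
    with \<open>u\<close>; the matrix maps \<open>v\<close> to \<open>c * d v\<close> times
    \<open>u\<close>.\<close>
  define d where "d v = u $ 1 * v $ 1 + u $ 2 * v $ 2" for v :: "complex^2"
  have A: "?A *v v = (c * d v) *s ?u" for v
    by (simp add: vec_eq_iff matrix_vector_mult_def sum_2 d_def algebra_simps)
  have du: "d ?u = complex_of_real (u \<bullet> u)"
    by (simp add: d_def inner_vec_def sum_2)
  have dk: "d (k *s v) = k * d v" for k v
    by (simp add: d_def algebra_simps)
  have u0: "?u \<noteq> 0" using assms by (auto simp: vec_eq_iff)
  show ?thesis
  proof (intro equalityI subsetI)
    fix k assume "k \<in> eigenvalues (\<chi> i j. c * u $ i * u $ j)"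
    then obtain v where v: "v \<noteq> 0" "(c * d v) *s ?u = k *s v"
      by (auto simp: eigenvalues_def A)
    show "k \<in> {0, complex_of_real (c * (u \<bullet> u))}"
    proof (cases "d v = 0")
      case True
      then show ?thesis using v by simp
    next
      case False
      \<comment> \<open>Applying \<open>d\<close> to the eigenvector equation makes it scalar, and
        \<open>d v\<close> can be cancelled.\<close>
      have "c * d v * complex_of_real (u \<bullet> u) = k * d v"
        using arg_cong[OF v(2), of d] by (simp only: dk du)
      then show ?thesis using False by simp
    qed
  next
    fix k assume k: "k \<in> {0, complex_of_real (c * (u \<bullet> u))}"
    \<comment> \<open>A quarter turn of \<open>u\<close>: a nonzero vector in the kernel of
      \<open>d\<close>, hence an eigenvector for 0.\<close>
    define w :: "complex^2"
      where "w = vector [complex_of_real (u $ 2), - complex_of_real (u $ 1)]"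
    have "w \<noteq> 0" using assms by (auto simp: w_def vec_eq_iff forall_2)
    moreover have "d w = 0" by (simp add: d_def w_def)
    ultimately have "0 \<in> eigenvalues (\<chi> i j. c * u $ i * u $ j)"
      by (auto simp: eigenvalues_def A intro!: exI[of _ w])
    moreover have "complex_of_real (c * (u \<bullet> u)) \<in> eigenvalues (\<chi> i j. c * u $ i * u $ j)"
      using u0 by (auto simp: eigenvalues_def A du intro!: exI[of _ ?u])
    ultimately show "k \<in> eigenvalues (\<chi> i j. c * u $ i * u $ j)" using k by auto
  qed
qed

text \<open>The derivative has matrix \<open>c * u $ i * u $ j\<close> with \<open>u = xe\<close>
  and \<open>c = - (lam / r\<^sup>2)\<close>, and \<open>xe \<bullet> xe = r\<^sup>2\<close> turns
  its second eigenvalue into \<open>- lam\<close>. Differentiability is stated as well because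
  \<open>jacobian\<close> is defined by choice and says nothing about the field without it.\<close>

lemma ccs_field_linearization:
  assumes "xe \<in> quadrant" "h r xe = 0"
  shows "ccs_field lam r differentiable (at xe)"
    "eigenvalues (jacobian (ccs_field lam r) (at xe)) = {0, - complex_of_real lam}"
proof -
  let ?D = "\<lambda>v. (- (lam / r\<^sup>2) * (xe \<bullet> v)) *\<^sub>R xe"
  note D = ccs_field_has_derivative_equilibrium[OF assms, of lam]
  show "ccs_field lam r differentiable (at xe)" using D by (auto simp: differentiable_def)
  have "jacobian (ccs_field lam r) (at xe) = matrix ?D"
    using frechet_derivative_at[OF D] by (simp add: jacobian_def)
  also have "\<dots> = (\<chi> i j. (- (lam / r\<^sup>2)) * xe $ i * xe $ j)"
    by (simp add: matrix_def vec_eq_iff inner_axis)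
  finally have "eigenvalues (jacobian (ccs_field lam r) (at xe))
      = {0, complex_of_real (- (lam / r\<^sup>2) * (xe \<bullet> xe))}"
    using eigenvalues_rank_one[of xe "- (lam / r\<^sup>2)"] quadrant_inner_pos[OF assms(1)] by auto
  moreover have "- (lam / r\<^sup>2) * (xe \<bullet> xe) = - lam"
    using assms quadrant_inner_pos[OF assms(1)] by (auto simp: h_eq_inner)
  ultimately show "eigenvalues (jacobian (ccs_field lam r) (at xe)) = {0, - complex_of_real lam}"
    by (simp only: of_real_minus)
qed

section \<open>Distance bounds for arbitrary solutions\<close>

text \<open>The conserved difference of logarithms fixes the ratio of the coordinates, and the
  common quadrant makes the factor positive. This covers every solution without an appeal to
  uniqueness.\<close>

lemma solution_eq_scaled_initial:
  assumes "is_solution (ccs_field lam r) quadrant J x" "0 \<in> J" "t \<in> J"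
  obtains k where "k > 0" "x t = k *\<^sub>R x 0"
proof -
  define k where "k = x t $ 1 / x 0 $ 1"
  have q: "x t $ 1 < 0" "x t $ 2 < 0" "x 0 $ 1 < 0" "x 0 $ 2 < 0"
    using assms by (auto simp: is_solution_def quadrant_def)
  have "ln (- (x t $ 1)) - ln (- (x t $ 2)) = ln (- (x 0 $ 1)) - ln (- (x 0 $ 2))"
    using ln_difference_constant_on[OF assms(1)] assms(2,3) unfolding constant_on_def by metis
  then have "ln (- (x t $ 1) * - (x 0 $ 2)) = ln (- (x 0 $ 1) * - (x t $ 2))"
    using q ln_mult_pos[of "- (x t $ 1)" "- (x 0 $ 2)"] ln_mult_pos[of "- (x 0 $ 1)" "- (x t $ 2)"]
    by linarith
  then have "x t $ 1 * x 0 $ 2 = x 0 $ 1 * x t $ 2"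
    using q by (subst (asm) ln_inj_iff) (auto simp: mult_neg_neg)
  then have "x t = k *\<^sub>R x 0"
    using q by (auto simp: vec_eq_iff forall_2 k_def field_simps)
  moreover have "k > 0" using q by (simp add: k_def divide_neg_neg)
  ultimately show ?thesis using that by blast
qed

text \<open>With the integrating factor \<open>exp (lam * s)\<close> the derivative becomes zero on
  the interval \<open>J\<close>; the resulting constant is compared at 0 and
  \<open>t\<close>.\<close>

lemma h_along_solution:
  assumes "is_solution (ccs_field lam r) quadrant J x" "0 \<in> J" "t \<in> J"
  shows "h r (x t) = h r (x 0) * exp (- lam * t)"
proof -
  have conv: "convex J" using assms by (simp add: is_solution_def is_interval_convex)
  have "((\<lambda>s. h r (x s) * exp (lam * s)) has_real_derivative 0) (at s within J)"
    if "s \<in> J" for s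
  proof -
    have "((\<lambda>s. exp (lam * s)) has_real_derivative lam * exp (lam * s)) (at s within J)"
      by (auto intro!: derivative_eq_intros)
    from DERIV_mult[OF h_has_derivative_along_solution[OF assms(1) that] this]
    show ?thesis by simp
  qed
  from has_field_derivative_zero_constant[OF conv this]
  obtain c where "h r (x s) * exp (lam * s) = c" if "s \<in> J" for s by blast
  from this[OF assms(2)] this[OF assms(3)]
  have "h r (x t) * exp (lam * t) = h r (x 0)" by simp
  then show ?thesis by (simp add: exp_minus field_simps)
qed

text \<open>The hypothesis makes the square of \<open>b\<close> a convex combination of the squares
  of \<open>a\<close> and \<open>c\<close>, so \<open>b\<close> lies between \<open>a\<close> and
  \<open>c\<close>. It serves for the initial norm \<open>a\<close>, the norm \<open>b\<close> at
  time \<open>t\<close>, the radius \<open>c\<close> and the decay factor \<open>d\<close>.\<close>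

lemma abs_diff_le_of_square_contraction:
  fixes a b c d :: real
  assumes "a \<ge> 0" "b \<ge> 0" "c \<ge> 0" "d \<ge> 0" "d \<le> 1" "b\<^sup>2 - c\<^sup>2 = (a\<^sup>2 - c\<^sup>2) * d"
  shows "\<bar>b - a\<bar> \<le> \<bar>a - c\<bar>"
proof (cases "c \<le> a")
  case True
  then have "c\<^sup>2 \<le> a\<^sup>2" using assms by (intro power_mono) auto
  then have "0 \<le> (a\<^sup>2 - c\<^sup>2) * d" "(a\<^sup>2 - c\<^sup>2) * d \<le> a\<^sup>2 - c\<^sup>2"
    using assms by (auto intro: mult_left_le)
  then have "c\<^sup>2 \<le> b\<^sup>2" "b\<^sup>2 \<le> a\<^sup>2" using assms by linarith+
  then have "c \<le> b" "b \<le> a" using assms power2_le_imp_le by blast+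
  then show ?thesis by simp
next
  case False
  then have "a\<^sup>2 \<le> c\<^sup>2" using assms by (intro power_mono) auto
  then have "0 \<le> (c\<^sup>2 - a\<^sup>2) * d" "(c\<^sup>2 - a\<^sup>2) * d \<le> c\<^sup>2 - a\<^sup>2"
    using assms by (auto intro: mult_left_le)
  moreover have "(a\<^sup>2 - c\<^sup>2) * d = - ((c\<^sup>2 - a\<^sup>2) * d)" by (simp add: algebra_simps)
  ultimately have "b\<^sup>2 \<le> c\<^sup>2" "a\<^sup>2 \<le> b\<^sup>2" using assms by linarith+
  then have "b \<le> c" "a \<le> b" using assms power2_le_imp_le by blast+
  then show ?thesis by simp
qed

lemma solution_dist_le:
  assumes "lam > 0" "r > 0" "is_solution (ccs_field lam r) quadrant J x" "J \<subseteq> {0..}" "0 \<in> J"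
    "t \<in> J" "norm xe = r"
  shows "norm (x t - xe) \<le> 2 * norm (x 0 - xe)"
proof -
  obtain k where k: "k > 0" "x t = k *\<^sub>R x 0"
    using solution_eq_scaled_initial[OF assms(3,5,6)] .
  have "t \<ge> 0" using assms by auto
  have "(norm (x t))\<^sup>2 - r\<^sup>2 = ((norm (x 0))\<^sup>2 - r\<^sup>2) * exp (- lam * t)"
    using h_along_solution[OF assms(3,5,6)] by (simp add: h_eq_inner power2_norm_eq_inner)
  then have "\<bar>norm (x t) - norm (x 0)\<bar> \<le> \<bar>norm (x 0) - r\<bar>"
    using \<open>t \<ge> 0\<close> assms(1,2) by (intro abs_diff_le_of_square_contraction[where d = "exp (- lam * t)"]) auto
  also have "\<dots> \<le> norm (x 0 - xe)" using assms(7) norm_triangle_ineq3 by metis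
  \<comment> \<open>On a common ray the absolute difference of the norms is the distance of the
    points, so the bound on norms becomes one on \<open>x t - x 0\<close>.\<close>
  also have "norm (x t) - norm (x 0) = (k - 1) * norm (x 0)"
    using k by (simp add: algebra_simps)
  finally have "norm (x t - x 0) \<le> norm (x 0 - xe)"
    using k by (simp add: abs_mult scaleR_left_diff_distrib[of k 1 "x 0", simplified, symmetric])
  then show ?thesis using norm_triangle_ineq[of "x t - x 0" "x 0 - xe"] by simp
qed

section \<open>Forward completeness and stability\<close>

lemma global_solution_exists:
  assumes "lam > 0" "r > 0" "x0 \<in> quadrant"
  shows "\<exists>x. is_solution (ccs_field lam r) quadrant {0..} x \<and> x 0 = x0"
proof -
  \<comment> \<open>The decay law for \<open>h\<close> forces \<open>N t\<close> to be the squared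
    norm of a solution at time \<open>t\<close>; \<open>k t\<close> is the scale factor that gives
    \<open>x0\<close> this norm.\<close>
  define N where "N t = r\<^sup>2 + h r x0 * exp (- lam * t)" for t
  define k where "k t = sqrt (N t / (x0 \<bullet> x0))" for t
  have p: "x0 \<bullet> x0 > 0" using quadrant_inner_pos assms by blast
  have N: "N t > 0" if "t \<ge> 0" for t
  proof -
    \<comment> \<open>For \<open>t \<ge> 0\<close> this is a convex combination of two positive
      numbers; at negative times \<open>N\<close> may become negative.\<close>
    have "N t = r\<^sup>2 * (1 - exp (- lam * t)) + (x0 \<bullet> x0) * exp (- lam * t)"
      by (simp add: N_def h_eq_inner algebra_simps)
    also have "\<dots> > 0"
      using that assms p by (intro add_nonneg_pos mult_nonneg_nonneg mult_pos_pos) auto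
    finally show ?thesis .
  qed
  have k: "k t > 0" "(k t)\<^sup>2 * (x0 \<bullet> x0) = N t" if "t \<ge> 0" for t
    using N[OF that] p by (auto simp: k_def)
  have "((\<lambda>t. k t *\<^sub>R x0) has_vector_derivative ccs_field lam r (k t *\<^sub>R x0)) (at t within {0..})"
    if "t \<ge> 0" for t
  proof -
    have kN: "(k t *\<^sub>R x0) \<bullet> (k t *\<^sub>R x0) = N t"
      using k(2)[OF that] by (simp add: power2_eq_square)
    have Nr: "N t - r\<^sup>2 = h r x0 * exp (- lam * t)" by (simp add: N_def)
    have "(N has_real_derivative - lam * (N t - r\<^sup>2)) (at t within {0..})"
      unfolding Nr unfolding N_def by (rule derivative_eq_intros refl)+ simp
    note N' = DERIV_cdivide[OF this, of "x0 \<bullet> x0"]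
    have "0 < N t / (x0 \<bullet> x0)" using N[OF that] p by simp
    from DERIV_chain2[OF DERIV_real_sqrt[OF this] N']
    have "(k has_real_derivative
        inverse (k t) / 2 * (- lam * (N t - r\<^sup>2) / (x0 \<bullet> x0))) (at t within {0..})"
      unfolding k_def .
    \<comment> \<open>Writing \<open>N t\<close> as \<open>(k t)\<^sup>2 * (x0 \<bullet> x0)\<close>
      shows that the derivative of the square root is the coefficient of the field times
      \<open>k t\<close>.\<close>
    also have "inverse (k t) / 2 * (- lam * (N t - r\<^sup>2) / (x0 \<bullet> x0))
        = - (lam * (N t - r\<^sup>2) / (2 * N t)) * k t"
      using k(1)[OF that] p by (simp add: k(2)[OF that, symmetric] field_simps power2_eq_square)
    finally have "((\<lambda>t. k t *\<^sub>R x0) has_vector_derivative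
        (- (lam * (N t - r\<^sup>2) / (2 * N t)) * k t) *\<^sub>R x0) (at t within {0..})"
      by (auto intro!: derivative_eq_intros)
    then show ?thesis unfolding ccs_field_eq_scaleR kN by simp
  qed
  then have "is_solution (ccs_field lam r) quadrant {0..} (\<lambda>t. k t *\<^sub>R x0)"
    using k(1) assms(3) by (auto simp: is_solution_def scaleR_in_quadrant is_interval_ci)
  moreover have "k 0 = 1" using p by (simp add: k_def N_def h_eq_inner)
  ultimately show ?thesis by (intro exI[of _ "\<lambda>t. k t *\<^sub>R x0"]) simp
qed

text \<open>Since \<open>r > 0\<close>, the equilibrium has norm \<open>r\<close>, and the factor 2
  in the distance bound is absorbed by halving \<epsilon>. The bound covers solutions on short
  intervals too; existence for all times is supplied separately.\<close>

lemma equilibrium_lyapunov_stable: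
  assumes "lam > 0" "r > 0" "xe \<in> equilibria (ccs_field lam r) quadrant"
  shows "lyapunov_stable (ccs_field lam r) quadrant xe"
proof -
  have "h r xe = 0" using assms equilibria_ccs_field by blast
  then have xe: "norm xe = r" using assms(2) by (simp add: h_eq_inner norm_eq_sqrt_inner)
  have "norm (x t - xe) < \<epsilon>"
    if "norm (x 0 - xe) < \<epsilon> / 2" "J \<subseteq> {0..}" "0 \<in> J"
      "is_solution (ccs_field lam r) quadrant J x" "t \<in> J" for \<epsilon> x J t
    using solution_dist_le[OF assms(1,2) that(4,2,3,5) xe] that(1) by simp
  then show ?thesis
    unfolding lyapunov_stable_def using assms(3) global_solution_exists[OF assms(1,2)]
    by (metis half_gt_zero)
qed

theorem mainTheorem4:
  fixes lam r :: real
  assumes "lam > 0" and "r > 0"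
  shows
    "equilibria (ccs_field lam r) quadrant = {x \<in> quadrant. h r x = 0}
     \<and> (\<forall>J x. is_solution (ccs_field lam r) quadrant J x \<longrightarrow>
          (\<forall>t\<in>J. ((\<lambda>s. h r (x s)) has_real_derivative - lam * h r (x t)) (at t within J)))
     \<and> (\<forall>xe \<in> equilibria (ccs_field lam r) quadrant.
          ccs_field lam r differentiable (at xe) \<and>
          eigenvalues (jacobian (ccs_field lam r) (at xe)) = {0, - complex_of_real lam})
     \<and> (\<forall>J x. is_solution (ccs_field lam r) quadrant J x \<longrightarrow>
          (\<lambda>t. ln (- (x t $ 1)) - ln (- (x t $ 2))) constant_on J)
     \<and> (\<forall>xe \<in> equilibria (ccs_field lam r) quadrant.
          lyapunov_stable (ccs_field lam r) quadrant xe)"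
  using equilibria_ccs_field[OF assms(1)] h_has_derivative_along_solution
    ccs_field_linearization ln_difference_constant_on equilibrium_lyapunov_stable[OF assms]
  by (intro conjI allI impI ballI) blast+

end
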